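(* Let $\delta_1,\delta_2>0$ with $\delta_1=M\delta_2$ for a positive integer $M$, and let $\gamma_{\delta_1},\gamma_{\delta_2}$ be the rescalings (see context) of a symmetric decreasing kernel $\gamma$ supported on $[0,1]$. The quasinonlocal coupling is $L^2$ stable: there is a constant $c>0$ such that $$b_{\mathsf{qnl}}(u,u)\ \ge\ c\,\|u\|_{L^2(\Omega\cup\Omega_{\mathcal I})}^2\qquad\text{for all }u\in S_{\mathsf{qnl}}.$$
   Context: Setting (one space dimension): $\Omega=[-a,b]$ with $a,b>0$, $\Omega_{\mathcal I}=\{y\in\mathbb{R}\setminus\Omega:\ |y-x|\le\delta_1\text{ for some }x\in\Omega\}$. Functions vanishing on $\Omega_{\mathcal I}$ are extended by zero to $\mathbb{R}$. Kernel: $\gamma$ is nonnegative, radially symmetric ($\gamma(x,y)=\gamma(|y-x|)$), decreasing, supported on $[0,1]$, with $\int s^2\gamma(s)\,ds<\infty$; $\gamma_\delta(s)=\delta^{-3}\gamma(s/\delta)$. Quasinonlocal bilinear form: $$b_{\mathsf{qnl}}(u,v)=\int_{x,y\in\mathbb{R},\,x\le0\text{ or }y\le0}\gamma_{\delta_1}(|y-x|)(u(y)-u(x))(v(y)-v(x))\,dx\,dy$$ $$+\int_{x,y\in\mathbb{R},\,x>0\text{ and }y>0}M\gamma_{\delta_1}(|y-x|)\sum_{j=0}^{M-1}\Big(u\big(x+\tfrac{j+1}{M}(y-x)\big)-u\big(x+\tfrac jM(y-x)\big)\Big)\Big(v\big(x+\tfrac{j+1}{M}(y-x)\big)-v\big(x+\tfrac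 jM(y-x)\big)\Big)dx\,dy.$$ $S_{\mathsf{qnl}}=\{u\in L^2(\Omega\cup\Omega_{\mathcal I}):\ b_{\mathsf{qnl}}(u,u)<\infty,\ u|_{\Omega_{\mathcal I}}=0\}$. The nonlocal energy norm $\|u\|_{S_{\delta_1}}^2=\int_{\Omega\cup\Omega_{\mathcal I}}\int_{\Omega\cup\Omega_{\mathcal I}}\gamma_{\delta_1}(|y-x|)(u(y)-u(x))^2\,dx\,dy$ is taken to satisfy the nonlocal Poincaré inequality $\|u\|_{S_{\delta_1}}\ge c\,\|u\|_{L^2(\Omega\cup\Omega_{\mathcal I})}$ for functions $u$ of finite norm vanishing on $\Omega_{\mathcal I}$. *)

theory Defs
  imports "HOL-Analysis.Analysis"
begin

text \<open>A kernel is given by its radial profile: \<open>\<gamma>(x,y) = \<gamma> \<bar>y - x\<bar>\<close>, so only its values on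
  \<open>[0, \<infinity>)\<close> matter. Monotonicity is required on \<open>(0, \<infinity>)\<close> only, so that kernels with a singularity
  at \<open>0\<close> are allowed (their value at \<open>0\<close> is then arbitrary).\<close>

definition admissible_kernel :: "(real \<Rightarrow> real) \<Rightarrow> bool" where
  "admissible_kernel \<gamma> \<longleftrightarrow>
     (\<forall>s\<ge>0. 0 \<le> \<gamma> s) \<and>
     (\<forall>s t. 0 < s \<and> s \<le> t \<longrightarrow> \<gamma> t \<le> \<gamma> s) \<and>
     (\<forall>s>1. \<gamma> s = 0) \<and>
     set_integrable lborel {0<..} (\<lambda>s. s\<^sup>2 * \<gamma> s)"

definition rescaled_kernel :: "(real \<Rightarrow> real) \<Rightarrow> real \<Rightarrow> real \<Rightarrow> real" where
  "rescaled_kernel \<gamma> \<delta> s = \<gamma> (s / \<delta>) / \<delta> ^ 3"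

definition Omega :: "real \<Rightarrow> real \<Rightarrow> real set" where
  "Omega a b = {-a..b}"

definition Omega_I :: "real \<Rightarrow> real \<Rightarrow> real \<Rightarrow> real set" where
  "Omega_I a b \<delta> = {y. y \<notin> Omega a b \<and> (\<exists>x\<in>Omega a b. \<bar>y - x\<bar> \<le> \<delta>)}"

text \<open>An element of \<open>L\<^sup>2(D)\<close> is represented by a function \<open>real \<Rightarrow> real\<close> of which only the values on
  \<open>D\<close> are used; every Lebesgue class has such a Borel representative.\<close>

definition L2 :: "real set \<Rightarrow> (real \<Rightarrow> real) set" where
  "L2 D = {u. set_borel_measurable lborel D u \<and> set_integrable lborel D (\<lambda>x. (u x)\<^sup>2)}"

definition L2_norm :: "real set \<Rightarrow> (real \<Rightarrow> real) \<Rightarrow> real" where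
  "L2_norm D u = sqrt (LINT x:D|lborel. (u x)\<^sup>2)"

definition zero_ext :: "real set \<Rightarrow> (real \<Rightarrow> real) \<Rightarrow> real \<Rightarrow> real" where
  "zero_ext D u x = (if x \<in> D then u x else 0)"

definition nonlocal_density ::
    "(real \<Rightarrow> real) \<Rightarrow> (real \<Rightarrow> real) \<Rightarrow> (real \<Rightarrow> real) \<Rightarrow> real \<times> real \<Rightarrow> real" where
  "nonlocal_density k u v = (\<lambda>(x, y). k \<bar>y - x\<bar> * (u y - u x) * (v y - v x))"

definition reconstructed_density ::
    "nat \<Rightarrow> (real \<Rightarrow> real) \<Rightarrow> (real \<Rightarrow> real) \<Rightarrow> (real \<Rightarrow> real) \<Rightarrow> real \<times> real \<Rightarrow> real" where
  "reconstructed_density M k u v = (\<lambda>(x, y). real M * k \<bar>y - x\<bar> *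
     (\<Sum>j<M. (u (x + real (j + 1) / real M * (y - x)) - u (x + real j / real M * (y - x))) *
             (v (x + real (j + 1) / real M * (y - x)) - v (x + real j / real M * (y - x)))))"

definition b_qnl ::
    "(real \<Rightarrow> real) \<Rightarrow> real \<Rightarrow> nat \<Rightarrow> (real \<Rightarrow> real) \<Rightarrow> (real \<Rightarrow> real) \<Rightarrow> real" where
  "b_qnl \<gamma> \<delta>1 M u v =
     (LINT p:{(x, y). x \<le> 0 \<or> y \<le> 0}|lborel. nonlocal_density (rescaled_kernel \<gamma> \<delta>1) u v p) +
     (LINT p:{(x, y). x > 0 \<and> y > 0}|lborel. reconstructed_density M (rescaled_kernel \<gamma> \<delta>1) u v p)"

text \<open>The Bochner integral is real-valued and \<open>0\<close> on non-integrable functions. For \<open>u = v\<close> both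
  integrands are nonnegative, so \<open>b_qnl(u,u) < \<infinity>\<close> means that both are integrable.\<close>

definition b_qnl_finite :: "(real \<Rightarrow> real) \<Rightarrow> real \<Rightarrow> nat \<Rightarrow> (real \<Rightarrow> real) \<Rightarrow> bool" where
  "b_qnl_finite \<gamma> \<delta>1 M u \<longleftrightarrow>
     set_integrable lborel {(x, y). x \<le> 0 \<or> y \<le> 0}
       (nonlocal_density (rescaled_kernel \<gamma> \<delta>1) u u) \<and>
     set_integrable lborel {(x, y). x > 0 \<and> y > 0}
       (reconstructed_density M (rescaled_kernel \<gamma> \<delta>1) u u)"

definition S_qnl :: "real \<Rightarrow> real \<Rightarrow> (real \<Rightarrow> real) \<Rightarrow> real \<Rightarrow> nat \<Rightarrow> (real \<Rightarrow> real) set" where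
  "S_qnl a b \<gamma> \<delta>1 M =
     {u \<in> L2 (Omega a b \<union> Omega_I a b \<delta>1).
        b_qnl_finite \<gamma> \<delta>1 M (zero_ext (Omega a b \<union> Omega_I a b \<delta>1) u) \<and>
        (AE x in lborel. x \<in> Omega_I a b \<delta>1 \<longrightarrow> u x = 0)}"

definition energy_norm ::
    "real \<Rightarrow> real \<Rightarrow> (real \<Rightarrow> real) \<Rightarrow> real \<Rightarrow> (real \<Rightarrow> real) \<Rightarrow> real" where
  "energy_norm a b \<gamma> \<delta> u =
     sqrt (LINT p:(Omega a b \<union> Omega_I a b \<delta>) \<times> (Omega a b \<union> Omega_I a b \<delta>)|lborel.
             nonlocal_density (rescaled_kernel \<gamma> \<delta>) u u p)"

text \<open>The integrability condition says that the energy norm is finite.\<close>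

definition S_nonlocal :: "real \<Rightarrow> real \<Rightarrow> (real \<Rightarrow> real) \<Rightarrow> real \<Rightarrow> (real \<Rightarrow> real) set" where
  "S_nonlocal a b \<gamma> \<delta> =
     {u \<in> L2 (Omega a b \<union> Omega_I a b \<delta>).
        set_integrable lborel ((Omega a b \<union> Omega_I a b \<delta>) \<times> (Omega a b \<union> Omega_I a b \<delta>))
          (nonlocal_density (rescaled_kernel \<gamma> \<delta>) u u) \<and>
        (AE x in lborel. x \<in> Omega_I a b \<delta> \<longrightarrow> u x = 0)}"

definition nonlocal_Poincare :: "real \<Rightarrow> real \<Rightarrow> (real \<Rightarrow> real) \<Rightarrow> real \<Rightarrow> bool" where
  "nonlocal_Poincare a b \<gamma> \<delta> \<longleftrightarrow>
     (\<exists>c>0. \<forall>u\<in>S_nonlocal a b \<gamma> \<delta>.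
        energy_norm a b \<gamma> \<delta> u \<ge> c * L2_norm (Omega a b \<union> Omega_I a b \<delta>) u)"

end

theory Submission
  imports Defs
begin

text \<open>
  The increment \<open>u(y) - u(x)\<close> telescopes into the \<open>M\<close> increments of the reconstruction, so by
  Cauchy--Schwarz the reconstructed density dominates the nonlocal density pointwise. Hence
  \<open>b_qnl(u,u)\<close> bounds the squared nonlocal energy norm from above, and the nonlocal Poincare
  inequality carries over.
\<close>

text \<open>Makes the domain an explicit interval, from which measurability of its square
  follows.\<close>

lemma Omega_Un_Omega_I_eq:
  assumes "0 \<le> a" "0 \<le> b" "0 \<le> \<delta>"
  shows "Omega a b \<union> Omega_I a b \<delta> = {-a-\<delta>..b+\<delta>}"
proof (intro equalityI subsetI)
  fix y assume y: "y \<in> {-a-\<delta>..b+\<delta>}"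
  \<comment> \<open>\<open>x\<close> is the projection of \<open>y\<close> onto [-a, b], that is,
    its nearest point in \<open>Omega a b\<close>.\<close>
  define x where "x = max (-a) (min b y)"
  have "x \<in> Omega a b" "\<bar>y - x\<bar> \<le> \<delta>"
    using y assms by (auto simp: x_def Omega_def max_def min_def)
  then show "y \<in> Omega a b \<union> Omega_I a b \<delta>"
    by (auto simp: Omega_I_def)
qed (use assms in \<open>auto simp: Omega_def Omega_I_def abs_le_iff\<close>)

lemma admissible_kernel_nonneg:
  assumes "admissible_kernel \<gamma>" "0 \<le> s"
  shows "0 \<le> \<gamma> s"
  using assms by (simp add: admissible_kernel_def)

text \<open>Integrability of \<open>s\<^sup>2 * \<gamma> s\<close> on the positive half-line
  includes measurability, and division by \<open>s\<^sup>2\<close> is harmless there. The cut-off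
  removes the negative arguments, where \<gamma> is unconstrained.\<close>

lemma admissible_kernel_measurable:
  assumes "admissible_kernel \<gamma>"
  shows "(\<lambda>s. indicator {0<..} s * \<gamma> s) \<in> borel_measurable borel"
proof -
  have "(\<lambda>s. indicator {0<..} s *\<^sub>R (s\<^sup>2 * \<gamma> s)) \<in> borel_measurable lborel"
    using assms unfolding admissible_kernel_def set_integrable_def
    by (auto dest: borel_measurable_integrable)
  then have "(\<lambda>s. indicator {0<..} s *\<^sub>R (s\<^sup>2 * \<gamma> s)) \<in> borel_measurable borel"
    by simp
  then have "(\<lambda>s. (indicator {0<..} s *\<^sub>R (s\<^sup>2 * \<gamma> s)) / s\<^sup>2) \<in> borel_measurable borel"
    by measurable
  also have "(\<lambda>s. (indicator {0<..} s *\<^sub>R (s\<^sup>2 * \<gamma> s)) / s\<^sup>2) = (\<lambda>s. indicator {0<..} s * \<gamma> s)"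
    by (auto simp: fun_eq_iff indicator_def)
  finally show ?thesis .
qed

lemma nonlocal_density_measurable:
  assumes "admissible_kernel \<gamma>" "\<delta> > 0" and [measurable]: "u \<in> borel_measurable borel"
  shows "nonlocal_density (rescaled_kernel \<gamma> \<delta>) u u \<in> borel_measurable borel"
proof -
  define g where "g = (\<lambda>s. indicator {0<..} s * \<gamma> s)"
  have [measurable]: "g \<in> borel_measurable borel"
    unfolding g_def by (rule admissible_kernel_measurable) fact
  have "(\<lambda>p::real \<times> real. g (\<bar>snd p - fst p\<bar> / \<delta>) / \<delta> ^ 3 * (u (snd p) - u (fst p)) * (u (snd p) - u (fst p)))
      \<in> borel_measurable (borel \<Otimes>\<^sub>M borel)"
    by measurable
  \<comment> \<open>Off the diagonal the argument of the kernel is positive, so \<open>g\<close> and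
    \<gamma> agree. On the diagonal the increment of \<open>u\<close> is 0, so the arbitrary value
    of \<gamma> at 0 is invisible.\<close>
  also have "(\<lambda>p::real \<times> real. g (\<bar>snd p - fst p\<bar> / \<delta>) / \<delta> ^ 3 * (u (snd p) - u (fst p)) * (u (snd p) - u (fst p)))
      = nonlocal_density (rescaled_kernel \<gamma> \<delta>) u u"
    using \<open>\<delta> > 0\<close> by (auto simp: fun_eq_iff nonlocal_density_def rescaled_kernel_def g_def indicator_def zero_less_divide_iff)
  finally show ?thesis
    by (simp add: borel_prod)
qed

lemma nonlocal_density_nonneg:
  assumes "\<And>s. 0 \<le> s \<Longrightarrow> 0 \<le> k s"
  shows "0 \<le> nonlocal_density k u u p"
  using assms by (auto simp: nonlocal_density_def mult.assoc split: prod.split)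

lemma nonlocal_density_le_reconstructed_density:
  assumes "\<And>s. 0 \<le> s \<Longrightarrow> 0 \<le> k s" and "M > 0"
  shows "nonlocal_density k u u p \<le> reconstructed_density M k u u p"
proof (cases p)
  case (Pair x y)
  define f where "f j = u (x + real j / real M * (y - x))" for j
  \<comment> \<open>The sum telescopes to \<open>f M - f 0\<close>, where \<open>f 0 = u x\<close>,
    and \<open>f M = u y\<close> because \<open>M > 0\<close> makes the last fraction equal to
    1.\<close>
  have "u y - u x = (\<Sum>j<M. f (Suc j) - f j)"
    unfolding sum_lessThan_telescope using \<open>M > 0\<close> by (simp add: f_def)
  \<comment> \<open>Cauchy--Schwarz against the constant 1 on \<open>M\<close> indices. The factor
    \<open>M\<close> that it costs is exactly the weight in
    \<open>reconstructed_density\<close>.\<close>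
  then have "(u y - u x)\<^sup>2 \<le> (\<Sum>j<M. (f (Suc j) - f j)\<^sup>2) * real M"
    using sum_squared_le_sum_of_squares[of "\<lambda>j. f (Suc j) - f j" "{..<M}"] \<open>M > 0\<close> by simp
  then have "k \<bar>y - x\<bar> * (u y - u x)\<^sup>2 \<le> k \<bar>y - x\<bar> * ((\<Sum>j<M. (f (Suc j) - f j)\<^sup>2) * real M)"
    by (intro mult_left_mono) (use assms in auto)
  then show ?thesis
    by (simp add: Pair nonlocal_density_def reconstructed_density_def f_def power2_eq_square mult_ac)
qed

text \<open>The plane is split into the two regions of \<open>b_qnl\<close>: on the first the
  integrands coincide, on the open quadrant the pointwise bound applies. Integrability is stated as
  well, since a nonintegrable function would have integral 0 by default.\<close>

lemma integral_nonlocal_density_le_b_qnl: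
  fixes u :: "real \<Rightarrow> real"
  assumes \<gamma>: "admissible_kernel \<gamma>" and "\<delta> > 0" "M > 0"
    and meas: "u \<in> borel_measurable borel" and fin: "b_qnl_finite \<gamma> \<delta> M u"
  shows "integrable lborel (nonlocal_density (rescaled_kernel \<gamma> \<delta>) u u)" (is "integrable _ ?f")
    and "(LINT p|lborel. nonlocal_density (rescaled_kernel \<gamma> \<delta>) u u p) \<le> b_qnl \<gamma> \<delta> M u u"
proof -
  let ?g = "reconstructed_density M (rescaled_kernel \<gamma> \<delta>) u u"
  define A :: "(real \<times> real) set" where "A = {(x, y). x \<le> 0 \<or> y \<le> 0}"
  define B :: "(real \<times> real) set" where "B = {(x, y). x > 0 \<and> y > 0}"
  have k: "0 \<le> rescaled_kernel \<gamma> \<delta> s" if "0 \<le> s" for s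
    using admissible_kernel_nonneg[OF \<gamma>] that \<open>\<delta> > 0\<close> by (simp add: rescaled_kernel_def)
  have fm [measurable]: "?f \<in> borel_measurable borel"
    using \<gamma> \<open>\<delta> > 0\<close> meas by (rule nonlocal_density_measurable)
  have f0: "0 \<le> ?f p" for p using k by (rule nonlocal_density_nonneg)
  have fg: "?f p \<le> ?g p" for p using k \<open>M > 0\<close> by (rule nonlocal_density_le_reconstructed_density)
  have "open B"
    unfolding B_def case_prod_beta by (intro open_Collect_conj open_Collect_less continuous_intros)
  then have Bm [measurable]: "B \<in> sets borel" by simp
  have AB: "A \<union> B = UNIV" "A \<inter> B = {}" and "A = - B" by (auto simp: A_def B_def)
  then have Am [measurable]: "A \<in> sets borel" by auto
  have fA: "set_integrable lborel A ?f" and gB: "set_integrable lborel B ?g"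
    using fin by (auto simp: b_qnl_finite_def A_def B_def)
  \<comment> \<open>Finiteness of \<open>b_qnl\<close> controls only \<open>?g\<close> on the
    quadrant \<open>B\<close>; integrability of \<open>?f\<close> there comes from
    domination.\<close>
  have fB: "set_integrable lborel B ?f"
  proof (rule set_integrable_bound[OF gB])
    show "set_borel_measurable lborel B ?f"
      unfolding set_borel_measurable_def by measurable
    show "AE p in lborel. p \<in> B \<longrightarrow> norm (?f p) \<le> norm (?g p)"
      using f0 fg by (intro AE_I2 impI) (simp add: order_trans[OF _ abs_ge_self])
  qed
  have "set_integrable lborel (A \<union> B) ?f"
    using fA fB by (rule set_integrable_Un) simp_all
  then show "integrable lborel ?f"
    by (simp add: AB set_integrable_def)
  have "(LINT p|lborel. ?f p) = (LINT p:A \<union> B|lborel. ?f p)"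
    by (simp add: AB set_lebesgue_integral_def)
  also have "\<dots> = (LINT p:A|lborel. ?f p) + (LINT p:B|lborel. ?f p)"
    using AB(2) fA fB by (rule set_integral_Un)
  also have "\<dots> \<le> (LINT p:A|lborel. ?f p) + (LINT p:B|lborel. ?g p)"
    using fg by (intro add_left_mono set_integral_mono fB gB)
  finally show "(LINT p|lborel. ?f p) \<le> b_qnl \<gamma> \<delta> M u u"
    by (simp add: b_qnl_def A_def B_def)
qed

text \<open>Passes from the whole plane and the zero extension to the energy norm over the domain.
  Membership in \<open>S_nonlocal\<close> is what opens the way to the Poincare inequality.\<close>

lemma S_qnl_energy:
  assumes \<gamma>: "admissible_kernel \<gamma>" and "0 \<le> a" "0 \<le> b" "\<delta> > 0" "M > 0"
    and u: "u \<in> S_qnl a b \<gamma> \<delta> M"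
  defines "w \<equiv> zero_ext (Omega a b \<union> Omega_I a b \<delta>) u"
  shows "u \<in> S_nonlocal a b \<gamma> \<delta>"
    and "(energy_norm a b \<gamma> \<delta> u)\<^sup>2 \<le> b_qnl \<gamma> \<delta> M w w"
proof -
  define D where "D = Omega a b \<union> Omega_I a b \<delta>"
  let ?k = "rescaled_kernel \<gamma> \<delta>"
  have "D = {-a-\<delta>..b+\<delta>}"
    unfolding D_def using assms by (intro Omega_Un_Omega_I_eq) auto
  then have DD: "D \<times> D \<in> sets lborel"
    by (auto simp flip: lborel_prod)
  have k: "0 \<le> ?k s" if "0 \<le> s" for s
    using admissible_kernel_nonneg[OF \<gamma>] that \<open>\<delta> > 0\<close> by (simp add: rescaled_kernel_def)
  have f0: "0 \<le> nonlocal_density ?k v v p" for v p using k by (rule nonlocal_density_nonneg)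
  have uL2: "u \<in> L2 D" and fin: "b_qnl_finite \<gamma> \<delta> M w"
    and zero: "AE x in lborel. x \<in> Omega_I a b \<delta> \<longrightarrow> u x = 0"
    using u by (auto simp: S_qnl_def D_def w_def)
  \<comment> \<open>Off \<open>D\<close> the representative \<open>u\<close> is arbitrary. Its zero
    extension is the product whose measurability \<open>set_borel_measurable\<close> asserts, so
    \<open>w\<close> is Borel on the whole line.\<close>
  have "w = (\<lambda>x. indicator D x *\<^sub>R u x)"
    by (auto simp: w_def zero_ext_def D_def fun_eq_iff)
  then have wm: "w \<in> borel_measurable borel"
    using uL2 by (simp add: L2_def set_borel_measurable_def)
  note int = integral_nonlocal_density_le_b_qnl[OF \<gamma> \<open>\<delta> > 0\<close> \<open>M > 0\<close> wm fin]
  \<comment> \<open>The density at a point of \<open>D \<times> D\<close> samples the function only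
    inside \<open>D\<close>, where \<open>u\<close> and \<open>w\<close> agree.\<close>
  have uw: "indicator (D \<times> D) p *\<^sub>R nonlocal_density ?k u u p =
      indicator (D \<times> D) p *\<^sub>R nonlocal_density ?k w w p" for p
    by (auto simp: w_def zero_ext_def D_def nonlocal_density_def indicator_def)
  have intD: "integrable lborel (\<lambda>p. indicator (D \<times> D) p *\<^sub>R nonlocal_density ?k w w p)"
    using DD int(1) by (rule integrable_mult_indicator)
  then have "set_integrable lborel (D \<times> D) (nonlocal_density ?k u u)"
    unfolding set_integrable_def uw .
  with uL2 zero show "u \<in> S_nonlocal a b \<gamma> \<delta>"
    by (simp add: S_nonlocal_def D_def)
  have "(energy_norm a b \<gamma> \<delta> u)\<^sup>2 = (LINT p:D \<times> D|lborel. nonlocal_density ?k u u p)"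
    unfolding energy_norm_def D_def[symmetric] set_lebesgue_integral_def
    by (intro real_sqrt_pow2 integral_nonneg_AE AE_I2) (simp add: f0)
  also have "\<dots> = (LINT p|lborel. indicator (D \<times> D) p *\<^sub>R nonlocal_density ?k w w p)"
    unfolding set_lebesgue_integral_def uw ..
  \<comment> \<open>The density of \<open>w\<close> is nonnegative, so enlarging
    \<open>D \<times> D\<close> to the plane can only increase the integral.\<close>
  also have "\<dots> \<le> (LINT p|lborel. nonlocal_density ?k w w p)"
    using intD int(1) by (rule integral_mono) (simp add: f0 indicator_def)
  also note int(2)
  finally show "(energy_norm a b \<gamma> \<delta> u)\<^sup>2 \<le> b_qnl \<gamma> \<delta> M w w" .
qed

theorem corollary3p1:
  fixes a b \<delta>1 \<delta>2 :: real and M :: nat and \<gamma> :: "real \<Rightarrow> real"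
  assumes "a > 0" and "b > 0"
    and "\<delta>1 > 0" and "\<delta>2 > 0"
    and "M > 0" and "\<delta>1 = real M * \<delta>2"
    and "admissible_kernel \<gamma>"
    and "nonlocal_Poincare a b \<gamma> \<delta>1"
  shows "\<exists>c>0. \<forall>u\<in>S_qnl a b \<gamma> \<delta>1 M.
           b_qnl \<gamma> \<delta>1 M (zero_ext (Omega a b \<union> Omega_I a b \<delta>1) u)
                       (zero_ext (Omega a b \<union> Omega_I a b \<delta>1) u)
             \<ge> c * (L2_norm (Omega a b \<union> Omega_I a b \<delta>1) u)\<^sup>2"
proof -
  let ?D = "Omega a b \<union> Omega_I a b \<delta>1"
  obtain c where "c > 0"
    and c: "\<And>u. u \<in> S_nonlocal a b \<gamma> \<delta>1 \<Longrightarrow> c * L2_norm ?D u \<le> energy_norm a b \<gamma> \<delta>1 u"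
    using \<open>nonlocal_Poincare a b \<gamma> \<delta>1\<close> by (auto simp: nonlocal_Poincare_def)
  show ?thesis
  \<comment> \<open>The Poincare inequality with constant \<open>c\<close> compares unsquared norms,
    whereas \<open>b_qnl\<close> is quadratic; squaring gives the constant
    \<open>c\<^sup>2\<close>.\<close>
  proof (intro exI[of _ "c\<^sup>2"] conjI ballI)
    fix u assume u: "u \<in> S_qnl a b \<gamma> \<delta>1 M"
    note E = S_qnl_energy[OF \<open>admissible_kernel \<gamma>\<close> less_imp_le[OF \<open>a > 0\<close>] less_imp_le[OF \<open>b > 0\<close>]
        \<open>\<delta>1 > 0\<close> \<open>M > 0\<close> u]
    have "0 \<le> L2_norm ?D u"
      unfolding L2_norm_def set_lebesgue_integral_def
      by (intro real_sqrt_ge_zero integral_nonneg_AE AE_I2) simp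
    then have "(c * L2_norm ?D u)\<^sup>2 \<le> (energy_norm a b \<gamma> \<delta>1 u)\<^sup>2"
      using c[OF E(1)] \<open>c > 0\<close> by (intro power_mono) auto
    also note E(2)
    finally show "c\<^sup>2 * (L2_norm ?D u)\<^sup>2 \<le> b_qnl \<gamma> \<delta>1 M (zero_ext ?D u) (zero_ext ?D u)"
      by (simp add: power_mult_distrib)
  qed (use \<open>c > 0\<close> in simp)
qed

end
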